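(* Let $A$ be an Archimedean semiprime $f$-algebra whose order dual separates its points, and let $a_0\in A$ be a positive element. Then $a_0$ is a weak order unit of $A$ if and only if, for every $a\in A$, the infimum $\inf\{|a-\lambda a_0| : \lambda\in\mathbb{R}\}$ exists in $A$ and equals $0$.
   Context: A Riesz algebra (lattice-ordered algebra) is a real associative algebra $A$ that is also a Riesz space (vector lattice) such that $ab\ge 0$ whenever $a,b\ge 0$. It is an $f$-algebra if $a\wedge b=0$ implies $ac\wedge b=ca\wedge b=0$ for all $0\le c\in A$. An $f$-algebra is semiprime if $0$ is its only nilpotent element (for Archimedean $f$-algebras: $a^2=0$ implies $a=0$). The order dual of $A$ (the space of order bounded linear functionals on $A$) separates points if for every $0\neq a\in A$ there is an order bounded linear functional $\varphi$ on $A$ with $\varphi(a)\ne 0$. A weak order unit of $A$ is an element $0\le e\in A$ such that $|a|\wedge e=0$ implies $a=0$ for all $a\in A$. *)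

theory Defs
  imports "HOL-Analysis.Analysis" "HOL-Library.Lattice_Algebras" "HOL-Library.Lub_Glb"
begin

class riesz_space = ordered_real_vector + lattice_ab_group_add_abs

class archimedean_riesz_space = riesz_space +
  assumes riesz_archimedean: "0 \<le> x \<Longrightarrow> (\<And>n::nat. real n *\<^sub>R x \<le> y) \<Longrightarrow> x = 0"

text \<open>No unit is assumed, and multiplication need not be commutative.\<close>

class riesz_algebra = real_algebra + ordered_real_vector + lattice_ring
begin

subclass riesz_space ..

end

class f_algebra = riesz_algebra +
  assumes f_algebra_right: "inf a b = 0 \<Longrightarrow> 0 \<le> c \<Longrightarrow> inf (a * c) b = 0"
    and f_algebra_left: "inf a b = 0 \<Longrightarrow> 0 \<le> c \<Longrightarrow> inf (c * a) b = 0"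

text \<open>
  Since there need not be a unit, the operator \<open>^\<close> is not available; the term
  \<open>(times a ^^ n) a\<close> is the power of \<open>a\<close> with exponent \<open>n + 1\<close>.
\<close>

definition (in ring) nilpotent :: "'a \<Rightarrow> bool"
  where "nilpotent a \<longleftrightarrow> (\<exists>n. (times a ^^ n) a = 0)"

class semiprime_f_algebra = f_algebra +
  assumes semiprime: "nilpotent a \<Longrightarrow> a = 0"

definition order_dual :: "('a::riesz_space \<Rightarrow> real) set"
  where "order_dual = {\<phi>. linear \<phi> \<and> (\<forall>x y. bounded (\<phi> ` {x..y}))}"

definition weak_order_unit :: "'a::riesz_space \<Rightarrow> bool"
  where "weak_order_unit e \<longleftrightarrow> 0 \<le> e \<and> (\<forall>a. inf \<bar>a\<bar> e = 0 \<longrightarrow> a = 0)"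

text \<open>The classes are inhabited.\<close>

instance real :: archimedean_riesz_space
proof
  fix x y :: real
  assume "0 \<le> x" and "\<And>n::nat. real n *\<^sub>R x \<le> y"
  then show "x = 0"
    by (metis ex_less_of_nat_mult less_eq_real_def linorder_not_le real_scaleR_def)
qed

instance real :: semiprime_f_algebra
proof
  fix a b c :: real
  assume "inf a b = 0" "0 \<le> c"
  then show "inf (a * c) b = 0" and "inf (c * a) b = 0"
    by (auto simp: inf_real_def min_def zero_le_mult_iff mult_le_0_iff split: if_splits)
next
  fix a :: real
  have "(times a ^^ n) a \<noteq> 0" if "a \<noteq> 0" for n
    using that by (induction n) auto
  moreover assume "nilpotent a"
  ultimately show "a = 0"
    unfolding nilpotent_def by blast
qed

end

theory Submission
  imports Defs
begin

text \<open>
  If \<open>a\<close> is disjoint from \<open>e\<close>, then subtracting a multiple of \<open>e\<close> from \<open>a\<close> cannot make its modulus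
  smaller, so \<open>\<bar>a\<bar>\<close> is itself a lower bound of all \<open>\<bar>a - l *\<^sub>R e\<bar>\<close>; a zero infimum forces \<open>a = 0\<close>.

  Conversely, think of \<open>a\<close> as a function measured in units of \<open>e\<close>, and of the grid of spacing \<open>1/N\<close>
  between \<open>- n\<close> and \<open>n\<close>. Where the value of \<open>a\<close> lies in this range, some grid point is within \<open>1/N\<close>
  of it; elsewhere the nearest grid point is an end of the range, at distance \<open>\<bar>a\<bar> - n\<close>.
  Hence a common lower bound \<open>b\<close> of the elements \<open>\<bar>a - l *\<^sub>R e\<bar>\<close> is at most the join of
  \<open>e/N\<close> and \<open>\<bar>a\<bar> - n *\<^sub>R e\<close> (\<open>grid_lower_bound_le\<close>). The Archimedean property is used twice:
  letting \<open>N\<close> grow replaces \<open>e/N\<close> by zero (\<open>lower_bound_le_excess\<close>), and letting \<open>n\<close> grow then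
  leaves no room for \<open>b\<close>, so \<open>b = 0\<close> as soon as \<open>0 \<le> b \<le> e\<close>
  (\<open>lower_bound_below_unit_eq_0\<close>). That \<open>e\<close> is a weak order unit is what permits the reduction
  to such \<open>b\<close>: a positive lower bound whose meet with \<open>e\<close> vanishes is zero.
\<close>

text \<open>
  A lattice-ordered group is distributive because \<open>inf a x = x - (sup a x - a)\<close>, and the correction
  \<open>sup a x - a\<close> grows with \<open>x\<close>: the correction \<open>d\<close> for \<open>x = sup b c\<close> also bounds those for
  \<open>b\<close> and \<open>c\<close>, so both lie below the right-hand side translated by \<open>d\<close>, and so does their join.
\<close>

lemma inf_sup_distrib_left_group:
  fixes a b c :: "'a::lattice_ab_group_add"
  shows "inf a (sup b c) = sup (inf a b) (inf a c)"
proof (rule order.antisym)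
  define m where "m = sup (inf a b) (inf a c)"
  define d where "d = sup a (sup b c) - a"
  have le: "x \<le> m + d" if "x \<le> sup b c" "inf a x \<le> m" for x
  proof -
    have "sup a x \<le> sup a (sup b c)"
      using that(1) by (simp add: le_supI2)
    then have "a + x \<le> sup a (sup b c) + m"
      unfolding add_eq_inf_sup[of a x] using that(2) by (rule add_mono)
    then show ?thesis
      by (simp add: d_def algebra_simps)
  qed
  have "sup b c \<le> m + d"
    using le[of b] le[of c] by (simp add: m_def)
  moreover have "inf a (sup b c) = sup b c - d"
    unfolding d_def using add_eq_inf_sup[of a "sup b c"]
    by (metis add_diff_cancel_left' diff_diff_eq2 add.commute)
  ultimately show "inf a (sup b c) \<le> sup (inf a b) (inf a c)"
    by (simp only: m_def diff_le_eq)
qed (simp add: le_infI2)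

lemma inf_sup_distrib_right_group:
  fixes a b c :: "'a::lattice_ab_group_add"
  shows "inf (sup b c) a = sup (inf b a) (inf c a)"
  using inf_sup_distrib_left_group[of a b c] by (simp only: inf.commute)

lemma inf_le_add:
  fixes u v :: "'a::riesz_space"
  assumes "0 \<le> u + v"
  shows "inf u v \<le> u + v"
proof -
  have "0 \<le> sup u v + sup u v"
    using assms add_mono[OF sup_ge1[of u v] sup_ge2[of v u]] by (rule order_trans)
  then have "0 \<le> sup u v"
    by (simp add: zero_le_double_add_iff_zero_le_single_add)
  then have "inf u v \<le> sup u v + inf u v"
    by simp
  then show ?thesis
    by (simp add: add_eq_inf_sup[of u v] add.commute)
qed

text \<open>
  The grid runs upwards from \<open>- m\<close>. If \<open>a\<close> lies above the current grid point, then the next one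
  either still lies below \<open>a\<close> or encloses \<open>a\<close> in an interval of length \<open>e\<close>, and in the second case
  one of the two distances is at most \<open>e\<close>. The distributive law turns this case distinction
  into an inequality in the lattice.
\<close>

lemma grid_lower_bound_le_aux:
  fixes a b e :: "'a::riesz_space"
  assumes "0 \<le> e" and lb: "\<And>l::real. b \<le> \<bar>a - l *\<^sub>R e\<bar>"
  shows "b \<le> sup (sup (a - (real k - m) *\<^sub>R e) e) (- a - m *\<^sub>R e)"
proof (induction k)
  case 0
  have "b \<le> sup (a + m *\<^sub>R e) (- a - m *\<^sub>R e)"
    using lb[of "- m"] by (simp add: abs_lattice)
  also have "\<dots> \<le> sup (sup (a - (real 0 - m) *\<^sub>R e) e) (- a - m *\<^sub>R e)"
    by (simp add: le_supI1)
  finally show ?case .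
next
  case (Suc k)
  define x where "x = a - (real k - m) *\<^sub>R e"
  define t where "t = - a - m *\<^sub>R e"
  have x_Suc: "a - (real (Suc k) - m) *\<^sub>R e = x - e"
    by (simp add: x_def algebra_simps)
  have "b \<le> sup (x - e) (e - x)"
    using lb[of "real (Suc k) - m"] unfolding x_Suc by (simp add: abs_lattice)
  moreover have "b \<le> sup (sup x e) t"
    using Suc.IH by (simp add: x_def t_def)
  ultimately have "b \<le> inf (sup (sup x e) t) (sup (x - e) (e - x))"
    by simp
  also have "\<dots> = sup (inf (sup (sup x e) t) (x - e))
      (sup (sup (inf x (e - x)) (inf e (e - x))) (inf t (e - x)))"
    by (simp only: inf_sup_distrib_left_group[of "sup (sup x e) t" "x - e" "e - x"]
        inf_sup_distrib_right_group[of _ _ "e - x"])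
  also have "\<dots> \<le> sup (sup (x - e) e) t"
  proof -
    have "inf x (e - x) \<le> e"
      using inf_le_add[of x "e - x"] \<open>0 \<le> e\<close> by simp
    then show ?thesis
      by (simp add: le_supI1 le_supI2 le_infI1 le_infI2)
  qed
  finally show ?case
    by (simp only: x_Suc t_def)
qed

lemma grid_lower_bound_le:
  fixes a b e :: "'a::riesz_space"
  assumes "0 \<le> e" and "\<And>l::real. b \<le> \<bar>a - l *\<^sub>R e\<bar>"
  shows "b \<le> sup e (\<bar>a\<bar> - real m *\<^sub>R e)"
proof -
  have "b \<le> sup (sup (a - real m *\<^sub>R e) e) (- a - real m *\<^sub>R e)"
    using grid_lower_bound_le_aux[OF assms, of "m + m" "real m"] by simp
  also have "\<dots> = sup e (sup (a - real m *\<^sub>R e) (- a - real m *\<^sub>R e))"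
    by (simp add: ac_simps)
  also have "sup (a - real m *\<^sub>R e) (- a - real m *\<^sub>R e) = \<bar>a\<bar> - real m *\<^sub>R e"
    using add_sup_distrib_right[of a "- a" "- (real m *\<^sub>R e)"] by (simp add: abs_lattice)
  finally show ?thesis .
qed

text \<open>
  Rescaling \<open>e\<close> to \<open>e/N\<close> refines the grid without changing the family of elements
  \<open>a - l *\<^sub>R e\<close>, so the Archimedean property disposes of the spacing.
\<close>

lemma lower_bound_le_excess:
  fixes a b e :: "'a::archimedean_riesz_space"
  assumes "0 \<le> e" and lb: "\<And>l::real. b \<le> \<bar>a - l *\<^sub>R e\<bar>"
  shows "b \<le> sup 0 (\<bar>a\<bar> - real n *\<^sub>R e)"
proof -
  define y where "y = sup 0 (\<bar>a\<bar> - real n *\<^sub>R e)"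
  have "sup 0 (b - y) = 0"
  proof (rule riesz_archimedean)
    fix N :: nat
    show "real N *\<^sub>R sup 0 (b - y) \<le> e"
    proof (cases "N = 0")
      case True
      then show ?thesis using \<open>0 \<le> e\<close> by simp
    next
      case False
      define d where "d = (1 / real N) *\<^sub>R e"
      have "0 \<le> d"
        using \<open>0 \<le> e\<close> by (simp add: d_def scaleR_nonneg_nonneg)
      moreover have "b \<le> \<bar>a - l *\<^sub>R d\<bar>" for l
        using lb[of "l / real N"] by (simp add: d_def)
      ultimately have "b \<le> sup d (\<bar>a\<bar> - real (n * N) *\<^sub>R d)"
        by (rule grid_lower_bound_le)
      also have "real (n * N) *\<^sub>R d = real n *\<^sub>R e"
        using False by (simp add: d_def)
      also have "sup d (\<bar>a\<bar> - real n *\<^sub>R e) \<le> d + y"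
        using add_mono[OF \<open>0 \<le> d\<close>, of "\<bar>a\<bar> - real n *\<^sub>R e" y]
        by (simp add: y_def)
      finally have "sup 0 (b - y) \<le> d"
        using \<open>0 \<le> d\<close> by (simp add: diff_le_eq)
      then have "real N *\<^sub>R sup 0 (b - y) \<le> real N *\<^sub>R d"
        by (simp add: scaleR_left_mono)
      then show ?thesis
        using False by (simp add: d_def)
    qed
  qed simp
  then have "b - y \<le> 0"
    by (metis sup_ge2)
  then show ?thesis
    by (simp only: y_def diff_le_0_iff_le)
qed

text \<open>
  Since \<open>b\<close> lies below \<open>e\<close>, it is a lower bound of the positive parts of
  \<open>\<bar>a\<bar> - n *\<^sub>R b\<close> as well. As long as \<open>n *\<^sub>R b \<le> \<bar>a\<bar>\<close>, this element is its own positive part and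
  there is room for one more copy of \<open>b\<close>; so all multiples of \<open>b\<close> stay below \<open>\<bar>a\<bar>\<close>.
\<close>

lemma lower_bound_below_unit_eq_0:
  fixes a b e :: "'a::archimedean_riesz_space"
  assumes "0 \<le> b" "b \<le> e" and lb: "\<And>l::real. b \<le> \<bar>a - l *\<^sub>R e\<bar>"
  shows "b = 0"
proof (rule riesz_archimedean)
  have "0 \<le> e"
    using assms(1,2) by (rule order_trans)
  show "real n *\<^sub>R b \<le> \<bar>a\<bar>" for n
  proof (induction n)
    case 0
    then show ?case by simp
  next
    case (Suc n)
    have "b \<le> sup 0 (\<bar>a\<bar> - real n *\<^sub>R e)"
      using \<open>0 \<le> e\<close> lb by (rule lower_bound_le_excess)
    also have "\<dots> \<le> sup 0 (\<bar>a\<bar> - real n *\<^sub>R b)"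
      using \<open>b \<le> e\<close> by (intro sup_mono diff_left_mono scaleR_left_mono) simp_all
    also have "\<dots> = \<bar>a\<bar> - real n *\<^sub>R b"
      using Suc.IH by (simp add: sup_absorb2)
    finally show ?case
      by (simp add: algebra_simps)
  qed
qed fact

lemma disjoint_abs_le_abs_diff_scaleR:
  fixes a e :: "'a::riesz_space"
  assumes "0 \<le> e" and disjoint: "inf \<bar>a\<bar> e = 0"
  shows "\<bar>a\<bar> \<le> \<bar>a - l *\<^sub>R e\<bar>"
proof -
  define r where "r = max 1 \<bar>l\<bar>"
  define w where "w = \<bar>a\<bar> - \<bar>a - l *\<^sub>R e\<bar>"
  \<comment> \<open>The bound \<open>1 \<le> r\<close> lets division by \<open>r\<close> preserve being below \<open>\<bar>a\<bar>\<close>; with \<open>\<bar>l\<bar> \<le> r\<close>, the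
    quotient \<open>w / r\<close> is then below both of the disjoint elements \<open>\<bar>a\<bar>\<close> and \<open>e\<close>.\<close>
  have r: "1 \<le> r" "l \<le> r" "- l \<le> r"
    by (auto simp: r_def)
  have "\<bar>l *\<^sub>R e\<bar> \<le> r *\<^sub>R e"
    using r \<open>0 \<le> e\<close> scaleR_right_mono[of "- l" r e]
    by (intro abs_leI) (simp_all add: scaleR_right_mono)
  moreover have "w \<le> \<bar>l *\<^sub>R e\<bar>"
    using abs_triangle_ineq[of "a - l *\<^sub>R e" "l *\<^sub>R e"] by (simp add: w_def algebra_simps)
  ultimately have "w \<le> r *\<^sub>R e"
    by (rule order_trans[rotated])
  then have "(1 / r) *\<^sub>R w \<le> (1 / r) *\<^sub>R (r *\<^sub>R e)"
    using r by (intro scaleR_left_mono) simp_all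
  then have "(1 / r) *\<^sub>R w \<le> e"
    using r by simp
  moreover have "(1 / r) *\<^sub>R w \<le> \<bar>a\<bar>"
  proof -
    have "(1 / r) *\<^sub>R w \<le> (1 / r) *\<^sub>R \<bar>a\<bar>"
      using r by (intro scaleR_left_mono) (simp_all add: w_def)
    also have "\<dots> \<le> 1 *\<^sub>R \<bar>a\<bar>"
      using r by (intro scaleR_right_mono) simp_all
    finally show ?thesis by simp
  qed
  ultimately have "(1 / r) *\<^sub>R w \<le> 0"
    using disjoint by (metis le_inf_iff)
  then have "r *\<^sub>R ((1 / r) *\<^sub>R w) \<le> r *\<^sub>R 0"
    using r by (intro scaleR_left_mono) simp_all
  then show ?thesis
    using r by (simp add: w_def)
qed

lemma isGlb_abs_diff_scaleR_iff:
  fixes a e :: "'a::riesz_space"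
  shows "isGlb UNIV (range (\<lambda>l::real. \<bar>a - l *\<^sub>R e\<bar>)) 0 \<longleftrightarrow>
    (\<forall>b. (\<forall>l::real. b \<le> \<bar>a - l *\<^sub>R e\<bar>) \<longrightarrow> b \<le> 0)"
  by (auto simp: isGlb_def greatestP_def isLb_def setge_def setle_def)

theorem weak_order_unit_iff_isGlb:
  fixes e :: "'a::archimedean_riesz_space"
  assumes "0 \<le> e"
  shows "weak_order_unit e \<longleftrightarrow>
    (\<forall>a. isGlb UNIV (range (\<lambda>l::real. \<bar>a - l *\<^sub>R e\<bar>)) 0)"
proof
  assume unit: "weak_order_unit e"
  have "b \<le> 0" if lb: "\<forall>l::real. b \<le> \<bar>a - l *\<^sub>R e\<bar>" for a b
  proof -
    have "inf (sup b 0) e = 0"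
      using assms lb by (intro lower_bound_below_unit_eq_0[of _ e a]) (auto intro: le_infI1)
    then have "inf \<bar>sup b 0\<bar> e = 0"
      by simp
    then have "sup b 0 = 0"
      using unit unfolding weak_order_unit_def by blast
    then show ?thesis
      by (metis sup_ge1)
  qed
  then show "\<forall>a. isGlb UNIV (range (\<lambda>l::real. \<bar>a - l *\<^sub>R e\<bar>)) 0"
    by (auto simp: isGlb_abs_diff_scaleR_iff)
next
  assume glb: "\<forall>a. isGlb UNIV (range (\<lambda>l::real. \<bar>a - l *\<^sub>R e\<bar>)) 0"
  have "a = 0" if "inf \<bar>a\<bar> e = 0" for a
  proof -
    have "\<forall>l. \<bar>a\<bar> \<le> \<bar>a - l *\<^sub>R e\<bar>"
      using disjoint_abs_le_abs_diff_scaleR[OF assms that] by blast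
    then have "\<bar>a\<bar> \<le> 0"
      using glb by (simp only: isGlb_abs_diff_scaleR_iff)
    then show ?thesis
      by simp
  qed
  then show "weak_order_unit e"
    using assms by (simp add: weak_order_unit_def)
qed

theorem proposition3:
  fixes a0 :: "'a::{semiprime_f_algebra, archimedean_riesz_space}"
  assumes "\<forall>a::'a. a \<noteq> 0 \<longrightarrow> (\<exists>\<phi>\<in>order_dual. \<phi> a \<noteq> 0)"
    and "0 \<le> a0"
  shows "weak_order_unit a0 \<longleftrightarrow>
    (\<forall>a::'a. isGlb UNIV (range (\<lambda>l::real. \<bar>a - l *\<^sub>R a0\<bar>)) 0)"
  using \<open>0 \<le> a0\<close> by (rule weak_order_unit_iff_isGlb)

end
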